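(* Let $E\subseteq\mathbb R^{+}$ and suppose that $0$ is an accumulation point of $E$. Then the following conditions are equivalent. (i) $E\in\hat I(\mathbf{SP})$. (ii) For every $q>1$, the set $\mathrm{Cc}^{1}E(q)$ is infinite and, writing $\mathrm{Cc}^{1}E(q)=\{(a_i,b_i)\}_{i\in\mathbb N}$, the inequality $$\limsup_{i\to\infty}\frac{b_i}{a_i}<\infty$$ holds.
   Context: $\mathbb R^{+}=[0,\infty)$ and $\mathbb N=\{1,2,\dots\}$. For $E\subseteq\mathbb R^{+}$ and $h>0$, $\lambda(E,0,h)$ is the length of the largest open subinterval of $(0,h)$ (possibly empty) that contains no point of $E$. The set $E$ is strongly porous on the right at $0$ if $\limsup_{h\to0^{+}}\lambda(E,0,h)/h=1$; $\mathbf{SP}$ is the collection of all $E\subseteq\mathbb R^{+}$ that are strongly porous on the right at $0$. A collection $I$ of subsets of $\mathbb R^{+}$ is an ideal on $\mathbb R^{+}$ if it is closed under taking subsets, closed under unions of two members, and $\mathbb R^{+}\notin I$. An ideal $I$ on $\mathbb R^{+}$ is $\mathbf{SP}$-maximal if $I\subseteq\mathbf{SP}$ and, for every ideal $J$ on $\mathbb R^{+}$, $I\subseteq J\subseteq\mathbf{SP}$ implies $I=J$. $\hat I(\mathbf{SP})$ is the intersection of all $\mathbf{SP}$-maximal ideals. For $q>1$, the $q$-blow up of $E$ is $E(q):=\bigcup_{x\in E}(q^{-1}x,qx)$ (for $x=0$ the interval is empty). $\mathrm{Cc}^{1}E(q)$ is the set of those connected components of $E(q)$ that are contained in $(0,1]$;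 these are open intervals. For nonempty $A,B\subseteq\mathbb R^{+}$ write $A\prec B$ if $b<a$ for all $a\in A$, $b\in B$. When $\mathrm{Cc}^{1}E(q)$ is infinite, there is a unique sequence of intervals $\{(a_i,b_i)\}_{i\in\mathbb N}$ that enumerates exactly the elements of $\mathrm{Cc}^{1}E(q)$ and satisfies $(a_i,b_i)\prec(a_j,b_j)\Leftrightarrow i<j$ (that is, the components are listed from right to left); the notation $\mathrm{Cc}^{1}E(q)=\{(a_i,b_i)\}_{i\in\mathbb N}$ refers to this enumeration. *)

theory Defs
  imports "HOL-Analysis.Analysis"
begin

text \<open>Length of the largest open subinterval of \<open>(0,h)\<close> without points of \<open>E\<close>. For \<open>h > 0\<close>
  the supremum is over a nonempty bounded set; \<open>u = v\<close> is the empty interval.\<close>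

definition gap_length :: "real set \<Rightarrow> real \<Rightarrow> real" where
  "gap_length E h = Sup {v - u | u v. 0 \<le> u \<and> u \<le> v \<and> v \<le> h \<and> {u<..<v} \<inter> E = {}}"

definition strongly_porous_right0 :: "real set \<Rightarrow> bool" where
  "strongly_porous_right0 E \<longleftrightarrow> Limsup (at_right 0) (\<lambda>h. ereal (gap_length E h / h)) = 1"

definition SP :: "real set set" where
  "SP = {E. E \<subseteq> {0..} \<and> strongly_porous_right0 E}"

definition ideal_on_Rplus :: "real set set \<Rightarrow> bool" where
  "ideal_on_Rplus I \<longleftrightarrow>
     I \<subseteq> Pow {0..} \<and>
     (\<forall>A\<in>I. \<forall>B\<subseteq>A. B \<in> I) \<and>
     (\<forall>A\<in>I. \<forall>B\<in>I. A \<union> B \<in> I) \<and>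
     {0..} \<notin> I"

definition SP_maximal :: "real set set \<Rightarrow> bool" where
  "SP_maximal I \<longleftrightarrow>
     ideal_on_Rplus I \<and> I \<subseteq> SP \<and>
     (\<forall>J. ideal_on_Rplus J \<longrightarrow> I \<subseteq> J \<longrightarrow> J \<subseteq> SP \<longrightarrow> I = J)"

definition hat_I_SP :: "real set set" where
  "hat_I_SP = \<Inter>{I. SP_maximal I}"

definition blow_up :: "real \<Rightarrow> real set \<Rightarrow> real set" where
  "blow_up q E = (\<Union>x\<in>E. {inverse q * x<..<q * x})"

definition Cc1 :: "real \<Rightarrow> real set \<Rightarrow> real set set" where
  "Cc1 q E = {C \<in> components (blow_up q E). C \<subseteq> {0<..1}}"

definition right_of :: "real set \<Rightarrow> real set \<Rightarrow> bool" where
  "right_of A B \<longleftrightarrow> (\<forall>a\<in>A. \<forall>b\<in>B. b < a)"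

text \<open>The intervals \<open>(a i, b i)\<close> list \<open>\<C>\<close> from right to left. Indices start at \<open>0\<close> instead
  of \<open>1\<close>, which does not affect upper limits.\<close>

definition lists_right_to_left :: "(nat \<Rightarrow> real) \<Rightarrow> (nat \<Rightarrow> real) \<Rightarrow> real set set \<Rightarrow> bool" where
  "lists_right_to_left a b \<C> \<longleftrightarrow>
     (\<forall>i. a i < b i) \<and>
     range (\<lambda>i. {a i<..<b i}) = \<C> \<and>
     (\<forall>i j. right_of {a i<..<b i} {a j<..<b j} \<longleftrightarrow> i < j)"

lemma open_interval_eq:
  fixes a b c d :: real
  assumes "{a<..<b} = {c<..<d}" "a < b" "c < d"
  shows "a = c" "b = d"
  using assms by (metis cInf_greaterThanLessThan, metis cSup_greaterThanLessThan)

lemma lists_right_to_left_unique: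
  assumes 1: "lists_right_to_left a b \<C>" and 2: "lists_right_to_left a' b' \<C>"
  shows "a = a' \<and> b = b'"
proof -
  define P where "P i = {a i<..<b i}" for i
  define Q where "Q i = {a' i<..<b' i}" for i
  have rng: "range P = \<C>" "range Q = \<C>"
    and ltA: "right_of (P i) (P j) \<longleftrightarrow> i < j"
    and ltB: "right_of (Q i) (Q j) \<longleftrightarrow> i < j"
    and ne: "a i < b i" "a' i < b' i" for i j
    using 1 2 unfolding lists_right_to_left_def P_def Q_def by simp_all
  have "\<forall>i. \<exists>j. P i = Q j" "\<forall>j. \<exists>i. Q j = P i"
    using rng by (metis rangeE rangeI)+
  then obtain s t where s: "\<And>i. P i = Q (s i)" and t: "\<And>j. Q j = P (t j)"
    by metis
  have "s i < s j \<longleftrightarrow> i < j" "t i < t j \<longleftrightarrow> i < j" for i j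
    using ltA[of i j] ltB[of "s i" "s j"] ltA[of "t i" "t j"] ltB[of i j] s[of i] s[of j] t[of i] t[of j]
    by argo+
  then have mono: "strict_mono s" "strict_mono t"
    by (simp_all add: strict_mono_def)
  have "P (t (s i)) = P i" for i
    using s t by simp
  then have ts: "t (s i) = i" for i
    using ltA[of i "t (s i)"] ltA[of "t (s i)" i] ltA[of i i] by simp
  have "i \<le> s i" "s i \<le> t (s i)" for i
    using mono by (simp_all add: strict_mono_imp_increasing)
  then have "s i = i" for i
    using ts by (simp add: le_antisym)
  then have "{a i<..<b i} = {a' i<..<b' i}" for i using s[of i] by (simp add: P_def Q_def)
  then have "a i = a' i" "b i = b' i" for i
    using open_interval_eq[OF _ ne(1) ne(2)] by simp_all
  then show ?thesis by auto
qed

text \<open>In particular the quotient \<open>b i / a i\<close> never divides by zero.\<close>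

lemma lists_right_to_left_Cc1_pos:
  assumes "lists_right_to_left a b (Cc1 q E)"
  shows "a i > 0"
proof -
  have lt: "\<And>i. a i < b i"
    and right: "right_of {a i<..<b i} {a (Suc i)<..<b (Suc i)}"
    and mem: "{a (Suc i)<..<b (Suc i)} \<in> Cc1 q E"
    using assms unfolding lists_right_to_left_def by auto
  obtain z where z: "z \<in> {a (Suc i)<..<b (Suc i)}"
    using dense[OF lt[of "Suc i"]] by auto
  have "{a (Suc i)<..<b (Suc i)} \<subseteq> {0<..1}"
    using mem unfolding Cc1_def by blast
  then have "0 < z" using z by (meson greaterThanAtMost_iff subsetD)
  moreover have "z \<le> a i"
  proof (rule dense_ge_bounded[OF lt[of i]])
    fix x assume "a i < x" "x < b i"
    then have "x \<in> {a i<..<b i}" by simp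
    then show "z \<le> x" using right z unfolding right_of_def by (meson less_imp_le)
  qed
  ultimately show ?thesis by linarith
qed

lemma lists_right_to_left_Cc1_exists:
  assumes q: "q > 1" and E: "E \<subseteq> {0..}" and inf: "infinite (Cc1 q E)"
  shows "\<exists>a b. lists_right_to_left a b (Cc1 q E)"
proof -
  let ?S = "Cc1 q E"
  have op: "open (blow_up q E)" unfolding blow_up_def by auto
  have comp: "C \<in> components (blow_up q E)" "C \<subseteq> {0<..1}" if "C \<in> ?S" for C
    using that unfolding Cc1_def by auto
  have ab: "\<exists>a b. a < b \<and> C = {a<..<b}" if C: "C \<in> ?S" for C
  proof -
    have o: "open C" using op comp[OF C] open_components by blast
    have c: "connected C" "C \<noteq> {}"
      using comp[OF C] in_components_connected in_components_nonempty by blast+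
    have bd: "bounded C" using comp(2)[OF C] by (meson bounded_subset bounded_Ioc)
    have "C = {Inf C<..<Sup C}"
    proof (rule set_eqI, rule iffI)
      fix x assume x: "x \<in> C"
      then obtain e where e: "e > 0" "ball x e \<subseteq> C" using o open_contains_ball by blast
      then have "x - e/2 \<in> C" "x + e/2 \<in> C" by (auto simp: subset_iff dist_real_def)
      then have "Inf C \<le> x - e/2" "x + e/2 \<le> Sup C"
        using bd by (auto intro!: cInf_lower cSup_upper bounded_imp_bdd_below bounded_imp_bdd_above)
      then show "x \<in> {Inf C<..<Sup C}" using e by auto
    next
      fix x assume "x \<in> {Inf C<..<Sup C}"
      then obtain y z where "y \<in> C" "y < x" "z \<in> C" "x < z"
        using c(2) bd by (auto simp: cInf_less_iff less_cSup_iff bounded_imp_bdd_below bounded_imp_bdd_above)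
      then show "x \<in> C" using c(1) unfolding connected_iff_interval by (meson less_imp_le)
    qed
    moreover have "Inf C < Sup C" using calculation c(2) by (metis greaterThanLessThan_empty_iff not_le)
    ultimately show ?thesis by blast
  qed
  have "\<exists>x. x \<in> C \<and> x > 0 \<and> x \<le> 1 \<and> {inverse q * x<..<q * x} \<subseteq> C" if C: "C \<in> ?S" for C
  proof -
    obtain y where y: "y \<in> C" using comp[OF C] in_components_nonempty by blast
    then have "y \<in> blow_up q E" using comp[OF C] in_components_subset by blast
    then obtain x where x: "x \<in> E" "y \<in> {inverse q * x<..<q * x}" unfolding blow_up_def by blast
    then have x0: "x > 0" using E q
      by (cases "x = 0") (auto simp: subset_iff order.strict_iff_order)
    have sub: "{inverse q * x<..<q * x} \<subseteq> C"
      by (rule components_maximal[OF comp(1)[OF C]]) (use x y in \<open>auto simp: blow_up_def\<close>)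
    have "x \<in> {inverse q * x<..<q * x}" using q x0 by (auto simp: field_simps)
    then show ?thesis using sub x0 comp(2)[OF C] by fastforce
  qed
  then obtain p where p: "\<And>C. C \<in> ?S \<Longrightarrow> p C \<in> C \<and> p C > 0 \<and> p C \<le> 1 \<and>
      {inverse q * p C<..<q * p C} \<subseteq> C" by metis
  define g where "g C = nat (- \<lfloor>log q (p C)\<rfloor>)" for C
  have eqC: "C = D" if "C \<in> ?S" "D \<in> ?S" "C \<inter> D \<noteq> {}" for C D
    using that comp components_nonoverlap by blast
  have trich: "right_of C D \<longleftrightarrow> p D < p C" if CD: "C \<in> ?S" "D \<in> ?S" "C \<noteq> D" for C D
  proof
    assume "right_of C D" then show "p D < p C" using p CD unfolding right_of_def by blast
  next
    assume lt: "p D < p C"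
    obtain a b c d where C: "C = {a<..<b}" and D: "D = {c<..<d}" using ab CD by metis
    have "max a c \<ge> min b d"
    proof (rule ccontr)
      assume "\<not> max a c \<ge> min b d"
      then obtain z where "max a c < z" "z < min b d" using dense by (metis not_le)
      then have "z \<in> C \<inter> D" using C D by auto
      then show False using eqC CD by blast
    qed
    then show "right_of C D" using lt p[OF CD(1)] p[OF CD(2)] unfolding right_of_def C D by auto
  qed
  have gless: "g C < g D" if CD: "C \<in> ?S" "D \<in> ?S" "C \<noteq> D" "p D < p C" for C D
  proof -
    have "\<not> p C < q * p D"
    proof
      assume "p C < q * p D"
      moreover have "inverse q * p D < p C"
      proof -
        have "inverse q * p D \<le> 1 * p D"
          using q p[OF CD(2)] by (intro mult_right_mono) (auto simp: field_simps)
        then show ?thesis using CD by auto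
      qed
      ultimately have "p C \<in> D" using p[OF CD(2)] by auto
      then show False using eqC CD p by blast
    qed
    then have "log q (q * p D) \<le> log q (p C)" using q p[OF CD(1)] p[OF CD(2)] by simp
    then have "1 + log q (p D) \<le> log q (p C)" using q p[OF CD(2)] by (simp add: log_mult)
    moreover have "log q (p C) \<le> 0" using q p[OF CD(1)] by simp
    ultimately show ?thesis unfolding g_def by linarith
  qed
  have prec: "right_of C D \<longleftrightarrow> g C < g D" if CD: "C \<in> ?S" "D \<in> ?S" for C D
  proof (cases "C = D")
    case True
    then show ?thesis using p[OF CD(1)] unfolding right_of_def by auto
  next
    case False
    have "p C \<noteq> p D" using False eqC p CD by (metis IntI empty_iff)
    then show ?thesis using trich[OF CD False] gless[OF CD False] gless[of D C] CD False
      by (metis less_asym linorder_less_linear)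
  qed
  have inj: "inj_on g ?S"
  proof (rule inj_onI, rule ccontr)
    fix C D assume *: "C \<in> ?S" "D \<in> ?S" "g C = g D" "C \<noteq> D"
    have "p C \<noteq> p D" using * eqC p by (metis IntI empty_iff)
    then show False using gless[of C D] gless[of D C] * by (metis less_irrefl linorder_less_linear)
  qed
  have infg: "infinite (g ` ?S)" using inf inj finite_image_iff by blast
  define F where "F i = the_inv_into ?S g (enumerate (g ` ?S) i)" for i
  have FS: "F i \<in> ?S" and gF: "g (F i) = enumerate (g ` ?S) i" for i
    unfolding F_def using inj enumerate_in_set[OF infg]
    by (auto intro!: the_inv_into_into f_the_inv_into_f)
  have rng: "range F = ?S"
  proof
    show "range F \<subseteq> ?S" using FS by blast
    show "?S \<subseteq> range F"
    proof
      fix C assume C: "C \<in> ?S"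
      then obtain i where "enumerate (g ` ?S) i = g C" using enumerate_Ex[OF infg, of "g C"] by blast
      then have "F i = C" using gF FS C inj by (metis inj_onD)
      then show "C \<in> range F" by blast
    qed
  qed
  have ord: "right_of (F i) (F j) \<longleftrightarrow> i < j" for i j
    using prec[OF FS FS] gF enumerate_mono_iff[OF infg] by simp
  have "\<forall>i. \<exists>a b. a < b \<and> F i = {a<..<b}" using ab FS by blast
  then obtain a where "\<forall>i. \<exists>b. a i < b \<and> F i = {a i<..<b}" unfolding choice_iff by blast
  then obtain b where F: "\<forall>i. a i < b i \<and> F i = {a i<..<b i}" unfolding choice_iff by blast
  then have "F = (\<lambda>i. {a i<..<b i})" by auto
  then have "lists_right_to_left a b ?S"
    unfolding lists_right_to_left_def using F rng ord by simp
  then show ?thesis by blast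
qed

end

theory Submission imports Defs begin

text \<open>By Zorn's lemma, \<open>E\<close> lies in every SP-maximal ideal iff adjoining \<open>E\<close> to any strongly
  porous set keeps it strongly porous. Both this and condition (ii) are equivalent to: for every
  \<open>q > 1\<close> the blow-up \<open>E(q)\<close> contains no intervals \<open>(u, M u)\<close> with \<open>u\<close> arbitrarily small and \<open>M\<close>
  arbitrarily large. If it does contain such intervals, then \<open>A = [0,\<infinity>) - E(q)\<close> is strongly
  porous, but \<open>E \<union> A\<close> has no gap of the form \<open>(s, q\<^sup>2 s)\<close>. If it does not, then every long
  gap of a set \<open>A\<close> contains a point \<open>x\<close> outside \<open>E(q)\<close>, hence the gap \<open>(x/q, q x)\<close> of \<open>E \<union> A\<close>.\<close>

section \<open>Strong porosity\<close>

lemma gap_length_bdd: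
  fixes h :: real
  shows "bdd_above {v - u | u v. 0 \<le> u \<and> u \<le> v \<and> v \<le> h \<and> {u<..<v} \<inter> E = {}}"
  by (rule bdd_aboveI[where M = h]) auto

lemma gap_length_le:
  assumes "h > 0"
  shows "gap_length E h \<le> h"
  unfolding gap_length_def
proof (rule cSup_least)
  have "0 - 0 \<in> {v - u | u v. 0 \<le> u \<and> u \<le> v \<and> v \<le> h \<and> {u<..<v} \<inter> E = {}}"
    using assms by (intro CollectI exI[of _ 0]) auto
  then show "{v - u | u v. 0 \<le> u \<and> u \<le> v \<and> v \<le> h \<and> {u<..<v} \<inter> E = {}} \<noteq> {}"
    by blast
qed auto

lemma gap_length_ge:
  assumes "0 \<le> u" "u \<le> v" "v \<le> h" "{u<..<v} \<inter> E = {}"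
  shows "v - u \<le> gap_length E h"
  unfolding gap_length_def
  by (rule cSup_upper[OF _ gap_length_bdd]) (use assms in blast)

text \<open>The supremum is not known to be attained, but every smaller value is exceeded by the
  length of an actual gap.\<close>

lemma less_gap_lengthE:
  assumes "y < gap_length E h" "h > 0"
  obtains u v where "0 \<le> u" "u \<le> v" "v \<le> h" "{u<..<v} \<inter> E = {}" "y < v - u"
proof -
  have "0 - 0 \<in> {v - u | u v. 0 \<le> u \<and> u \<le> v \<and> v \<le> h \<and> {u<..<v} \<inter> E = {}}"
    using assms(2) by (intro CollectI exI[of _ 0]) auto
  then have "{v - u | u v. 0 \<le> u \<and> u \<le> v \<and> v \<le> h \<and> {u<..<v} \<inter> E = {}} \<noteq> {}"
    by blast
  from less_cSupD[OF this assms(1)[unfolded gap_length_def]]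
  show thesis using that by blast
qed

lemma le_Limsup_iff:
  fixes X :: "'a \<Rightarrow> 'b :: {complete_linorder, dense_order}"
  shows "C \<le> Limsup F X \<longleftrightarrow> (\<forall>y<C. \<exists>\<^sub>F x in F. y < X x)"
proof (intro iffI allI impI)
  fix y assume "C \<le> Limsup F X" "y < C"
  then have "\<not> Limsup F X \<le> y" by auto
  then have "\<not> (\<forall>\<^sub>F x in F. X x \<le> y)" using Limsup_bounded by blast
  then show "\<exists>\<^sub>F x in F. y < X x" by (simp add: not_eventually not_le)
next
  assume fr: "\<forall>y<C. \<exists>\<^sub>F x in F. y < X x"
  show "C \<le> Limsup F X"
  proof (rule ccontr)
    assume "\<not> C \<le> Limsup F X"
    then obtain y where y: "Limsup F X < y" "y < C" using dense by (metis not_le)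
    have "\<forall>\<^sub>F x in F. \<not> y < X x" using Limsup_lessD[OF y(1)] by eventually_elim simp
    then show False using fr y(2) unfolding frequently_def by blast
  qed
qed

lemma frequently_at_right_0:
  "(\<exists>\<^sub>F h in at_right (0::real). P h) \<longleftrightarrow> (\<forall>\<delta>>0. \<exists>h. 0 < h \<and> h < \<delta> \<and> P h)"
  unfolding frequently_def eventually_at_right_field by auto

text \<open>A gap that nearly fills \<open>(0, h)\<close> starts near 0 and ends near
  \<open>h\<close>, so its endpoints have a large ratio; conversely a gap \<open>(u, K u)\<close>
  fills the fraction \<open>1 - 1 / K\<close> of \<open>(0, K u)\<close>. Porosity is used below in
  this scale-invariant form.\<close>

lemma strongly_porous_right0_iff:
  "strongly_porous_right0 E \<longleftrightarrow>
    (\<forall>K>1. \<forall>\<delta>>0. \<exists>u. 0 < u \<and> u < \<delta> \<and> {u<..<K * u} \<inter> E = {})"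
proof
  assume "strongly_porous_right0 E"
  then have "1 \<le> Limsup (at_right 0) (\<lambda>h. ereal (gap_length E h / h))"
    unfolding strongly_porous_right0_def by simp
  then have fr: "\<exists>\<^sub>F h in at_right 0. y < ereal (gap_length E h / h)" if "y < 1" for y
    using that unfolding le_Limsup_iff by blast
  show "\<forall>K>1. \<forall>\<delta>>0. \<exists>u. 0 < u \<and> u < \<delta> \<and> {u<..<K * u} \<inter> E = {}"
  proof (intro allI impI)
    fix K \<delta> :: real assume K: "K > 1" and "\<delta> > 0"
    \<comment> \<open>A gap longer than \<open>K h / (K + 1)\<close> leaves less than
      \<open>w = h / (K + 1)\<close> of \<open>(0, h)\<close> uncovered. Since
      \<open>w + K w = h\<close>, it must contain \<open>(w, K w)\<close>.\<close>
    have "ereal (K / (K + 1)) < 1" using K by simp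
    from fr[OF this] \<open>\<delta> > 0\<close> obtain h
      where h: "0 < h" "h < \<delta>" "K / (K + 1) < gap_length E h / h"
      unfolding frequently_at_right_0 by auto
    then have "K * h / (K + 1) < gap_length E h"
      by (simp add: pos_less_divide_eq)
    then obtain u v where uv: "0 \<le> u" "v \<le> h" "{u<..<v} \<inter> E = {}" "K * h / (K + 1) < v - u"
      using h less_gap_lengthE by metis
    define w where "w = h / (K + 1)"
    have "w * (K + 1) = h" using K by (simp add: w_def)
    then have wK: "w + K * w = h" by (simp add: algebra_simps)
    have "K * w = K * h / (K + 1)" by (simp add: w_def)
    then have "u \<le> w" "K * w \<le> v" using uv wK by linarith+
    then have "{w<..<K * w} \<inter> E = {}" using uv(3) by force
    moreover have "0 < w" using K h by (simp add: w_def)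
    moreover have "0 < K * w" using K \<open>0 < w\<close> by simp
    ultimately show "\<exists>u. 0 < u \<and> u < \<delta> \<and> {u<..<K * u} \<inter> E = {}"
      using wK h(2) by (intro exI[of _ w]) auto
  qed
next
  assume gaps: "\<forall>K>1. \<forall>\<delta>>0. \<exists>u. 0 < u \<and> u < \<delta> \<and> {u<..<K * u} \<inter> E = {}"
  have "Limsup (at_right 0) (\<lambda>h. ereal (gap_length E h / h)) \<le> 1"
  proof (rule Limsup_bounded)
    show "\<forall>\<^sub>F h in at_right 0. ereal (gap_length E h / h) \<le> 1"
      using eventually_at_right_less[of 0]
      by eventually_elim (simp add: gap_length_le)
  qed
  moreover have "1 \<le> Limsup (at_right 0) (\<lambda>h. ereal (gap_length E h / h))"
    unfolding le_Limsup_iff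
  proof (intro allI impI)
    fix y :: ereal assume "y < 1"
    then obtain r where r: "y < ereal r" "ereal r < 1" using ereal_dense2 by blast
    \<comment> \<open>The fraction \<open>(K - 1) / K\<close> is at least \<open>r\<close> once
      \<open>K \<ge> 1 / (1 - r)\<close>; the 2 keeps \<open>K > 1\<close> when
      \<open>r \<le> 0\<close>.\<close>
    define K where "K = max 2 (1 / (1 - r))"
    have K: "K > 1" by (simp add: K_def)
    have "1 / (1 - r) \<le> K" by (simp add: K_def)
    then have rK: "r * K \<le> K - 1" using r(2) by (simp add: field_simps)
    show "\<exists>\<^sub>F h in at_right 0. y < ereal (gap_length E h / h)"
      unfolding frequently_at_right_0
    proof (intro allI impI)
      fix \<delta> :: real assume "\<delta> > 0"
      then obtain u where u: "0 < u" "u < \<delta> / K" "{u<..<K * u} \<inter> E = {}"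
        using gaps K by (meson divide_pos_pos less_trans zero_less_one)
      have h: "0 < K * u" "K * u < \<delta>" using u K by (simp_all add: field_simps)
      have "K * u - u \<le> gap_length E (K * u)"
        using u K by (intro gap_length_ge) auto
      moreover have "r * K * u \<le> (K - 1) * u" using rK u by (intro mult_right_mono) auto
      ultimately have "r * (K * u) \<le> gap_length E (K * u)" by (simp add: algebra_simps)
      then have "r \<le> gap_length E (K * u) / (K * u)" using h by (simp add: pos_le_divide_eq)
      then have "y < ereal (gap_length E (K * u) / (K * u))"
        using r(1) by (meson ereal_less_eq(3) less_le_trans)
      then show "\<exists>h. 0 < h \<and> h < \<delta> \<and> y < ereal (gap_length E h / h)"
        using h by blast
    qed
  qed
  ultimately show "strongly_porous_right0 E"
    unfolding strongly_porous_right0_def by (rule antisym)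
qed

lemma SP_iff:
  "E \<in> SP \<longleftrightarrow> E \<subseteq> {0..} \<and>
    (\<forall>K>1. \<forall>\<delta>>0. \<exists>u. 0 < u \<and> u < \<delta> \<and> {u<..<K * u} \<inter> E = {})"
  unfolding SP_def strongly_porous_right0_iff by simp

lemma SP_subset:
  assumes "A \<in> SP" "B \<subseteq> A"
  shows "B \<in> SP"
  using assms unfolding SP_iff by (meson disjoint_iff subset_iff)

lemma empty_in_SP: "{} \<in> SP"
  unfolding SP_iff by (auto intro: dense)

lemma Rplus_notin_SP: "{0..} \<notin> SP"
proof
  assume "{0..} \<in> SP"
  then obtain u :: real where u: "0 < u" "{u<..<2 * u} \<inter> {0..} = {}"
    unfolding SP_iff by (meson one_less_numeral_iff semiring_norm(76) zero_less_one)
  from u(1) have "3 / 2 * u \<in> {u<..<2 * u} \<inter> {0..}" by simp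
  then show False using u(2) by blast
qed

section \<open>The intersection of the maximal ideals\<close>

text \<open>Zorn's lemma for the ideals inside \<open>SP\<close> that contain \<open>A\<close>.
  \<open>Pow A\<close> is one of them, and two members of the union of a chain already lie in a
  single ideal of the chain.\<close>

lemma exists_SP_maximal:
  assumes "A \<in> SP"
  obtains I where "SP_maximal I" "A \<in> I"
proof -
  define \<I> where "\<I> = {J. ideal_on_Rplus J \<and> J \<subseteq> SP \<and> A \<in> J}"
  have "ideal_on_Rplus (Pow A)" "Pow A \<subseteq> SP"
    using assms SP_subset Rplus_notin_SP unfolding ideal_on_Rplus_def SP_def by blast+
  then have ne: "\<I> \<noteq> {}" unfolding \<I>_def by blast
  have "\<Union>\<C> \<in> \<I>" if C: "\<C> \<noteq> {}" "subset.chain \<I> \<C>" for \<C>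
  proof -
    have sub: "\<And>J. J \<in> \<C> \<Longrightarrow> ideal_on_Rplus J \<and> J \<subseteq> SP \<and> A \<in> J"
      and lin: "\<And>J J'. J \<in> \<C> \<Longrightarrow> J' \<in> \<C> \<Longrightarrow> J \<subseteq> J' \<or> J' \<subseteq> J"
      using C(2) unfolding subset.chain_def \<I>_def by auto
    have "X \<union> Y \<in> \<Union>\<C>" if XY: "X \<in> \<Union>\<C>" "Y \<in> \<Union>\<C>" for X Y
    proof -
      obtain J J' where J: "J \<in> \<C>" "X \<in> J" "J' \<in> \<C>" "Y \<in> J'" using XY by blast
      then obtain L where "L \<in> \<C>" "X \<in> L" "Y \<in> L" using lin by blast
      then show ?thesis using sub unfolding ideal_on_Rplus_def by blast
    qed
    moreover have "Y \<in> \<Union>\<C>" if "X \<in> \<Union>\<C>" "Y \<subseteq> X" for X Y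
      using that sub unfolding ideal_on_Rplus_def by blast
    moreover have "\<Union>\<C> \<subseteq> SP" "A \<in> \<Union>\<C>" using sub C(1) by blast+
    ultimately show ?thesis
      using Rplus_notin_SP unfolding \<I>_def ideal_on_Rplus_def SP_def by blast
  qed
  from subset_Zorn_nonempty[OF ne this]
  obtain I where I: "I \<in> \<I>" "\<And>J. J \<in> \<I> \<Longrightarrow> I \<subseteq> J \<Longrightarrow> J = I" by blast
  \<comment> \<open>Any ideal above \<open>I\<close> contains \<open>A\<close> as well, so
    maximality within \<open>\<I>\<close> is maximality among all ideals inside
    \<open>SP\<close>.\<close>
  then have "SP_maximal I" "A \<in> I" unfolding SP_maximal_def \<I>_def by blast+
  then show thesis by (rule that)
qed

text \<open>Forward, a maximal ideal around \<open>A\<close> also contains \<open>E\<close>, hence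
  \<open>E \<union> A\<close>. Backward, \<open>E\<close> and a maximal ideal generate an ideal that
  stays inside \<open>SP\<close>, so maximality puts \<open>E\<close> into the given ideal.\<close>

lemma hat_I_SP_iff: "E \<in> hat_I_SP \<longleftrightarrow> (\<forall>A\<in>SP. E \<union> A \<in> SP)"
proof
  assume E: "E \<in> hat_I_SP"
  show "\<forall>A\<in>SP. E \<union> A \<in> SP"
  proof
    fix A assume "A \<in> SP"
    then obtain I where I: "SP_maximal I" "A \<in> I" by (rule exists_SP_maximal)
    then have "E \<in> I" using E unfolding hat_I_SP_def by blast
    then show "E \<union> A \<in> SP" using I unfolding SP_maximal_def ideal_on_Rplus_def by blast
  qed
next
  assume add: "\<forall>A\<in>SP. E \<union> A \<in> SP"
  have "E \<in> I" if I: "SP_maximal I" for I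
  proof -
    \<comment> \<open>\<open>{}\<close> has to be inserted because the empty family is an ideal.\<close>
    define J where "J = {B. \<exists>A\<in>insert {} I. B \<subseteq> E \<union> A}"
    have I': "ideal_on_Rplus I" "I \<subseteq> SP"
      and max: "\<And>J. ideal_on_Rplus J \<Longrightarrow> I \<subseteq> J \<Longrightarrow> J \<subseteq> SP \<Longrightarrow> I = J"
      using I unfolding SP_maximal_def by blast+
    have JSP: "J \<subseteq> SP"
    proof
      fix B assume "B \<in> J"
      then obtain A where "A \<in> SP" "B \<subseteq> E \<union> A"
        using I'(2) empty_in_SP unfolding J_def by blast
      then show "B \<in> SP" using add SP_subset by blast
    qed
    have "X \<union> Y \<in> J" if XY: "X \<in> J" "Y \<in> J" for X Y
    proof -
      obtain A B where AB: "A \<in> insert {} I" "X \<subseteq> E \<union> A" "B \<in> insert {} I" "Y \<subseteq> E \<union> B"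
        using XY unfolding J_def by blast
      have "A \<union> B \<in> insert {} I" using AB I'(1) unfolding ideal_on_Rplus_def by auto
      moreover have "X \<union> Y \<subseteq> E \<union> (A \<union> B)" using AB by blast
      ultimately show ?thesis unfolding J_def by blast
    qed
    moreover have "Y \<in> J" if "X \<in> J" "Y \<subseteq> X" for X Y
      using that unfolding J_def by blast
    ultimately have "ideal_on_Rplus J"
      using JSP Rplus_notin_SP unfolding ideal_on_Rplus_def SP_def by blast
    moreover have "I \<subseteq> J" unfolding J_def by blast
    ultimately have "I = J" using max JSP by blast
    moreover have "E \<in> J" unfolding J_def by blast
    ultimately show ?thesis by simp
  qed
  then show "E \<in> hat_I_SP" unfolding hat_I_SP_def by blast
qed

section \<open>Long intervals in the blow-up\<close>

text \<open>On a logarithmic scale, the intervals inside \<open>U\<close> near 0 have bounded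
  length. A set is strongly porous exactly when its complement fails this.\<close>

definition long_free :: "real set \<Rightarrow> bool" where
  "long_free U \<longleftrightarrow> (\<exists>M>1. \<exists>\<delta>>0. \<forall>u. 0 < u \<longrightarrow> u < \<delta> \<longrightarrow> \<not> {u<..<M * u} \<subseteq> U)"

lemma blow_up_pos:
  assumes "E \<subseteq> {0..}" "q > 1" "y \<in> blow_up q E"
  shows "y > 0"
proof -
  obtain x where x: "x \<in> E" "inverse q * x < y" using assms(3) unfolding blow_up_def by auto
  then have "0 \<le> inverse q * x" using assms by (intro mult_nonneg_nonneg) auto
  then show ?thesis using x by linarith
qed

lemma mem_blow_up:
  assumes "x \<in> E" "x > 0" "q > 1"
  shows "x \<in> blow_up q E"
  unfolding blow_up_def using assms by (auto intro!: bexI[of _ x] simp: field_simps)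

text \<open>Differing by a factor less than \<open>q\<close> is a symmetric relation:
  \<open>e\<close> lies in \<open>(x / q, q x)\<close> iff \<open>x\<close> lies in the interval
  around \<open>e\<close>.\<close>

lemma gap_iff_notin_blow_up:
  assumes "q > 1"
  shows "{x / q<..<q * x} \<inter> E = {} \<longleftrightarrow> x \<notin> blow_up q E"
proof -
  have "e \<in> {x / q<..<q * x} \<longleftrightarrow> x \<in> {inverse q * e<..<q * e}" for e
    using assms by (auto simp: field_simps)
  then show ?thesis unfolding blow_up_def by blast
qed

lemma union_in_SP_iff_long_free:
  assumes E: "E \<subseteq> {0..}"
  shows "(\<forall>A\<in>SP. E \<union> A \<in> SP) \<longleftrightarrow> (\<forall>q>1. long_free (blow_up q E))"
proof
  assume add: "\<forall>A\<in>SP. E \<union> A \<in> SP"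
  show "\<forall>q>1. long_free (blow_up q E)"
  proof (intro allI impI, rule ccontr)
    fix q :: real assume q: "q > 1" and "\<not> long_free (blow_up q E)"
    then have long: "\<exists>u. 0 < u \<and> u < \<delta> \<and> {u<..<M * u} \<subseteq> blow_up q E" if "M > 1" "\<delta> > 0" for M \<delta>
      using that unfolding long_free_def by blast
    have "{0..} - blow_up q E \<in> SP"
      unfolding SP_iff
    proof (intro conjI allI impI)
      fix K \<delta> :: real assume "K > 1" "\<delta> > 0"
      then show "\<exists>u. 0 < u \<and> u < \<delta> \<and> {u<..<K * u} \<inter> ({0..} - blow_up q E) = {}"
        using long[of K \<delta>] by blast
    qed auto
    then have "E \<union> ({0..} - blow_up q E) \<in> SP" using add by blast
    \<comment> \<open>The gap \<open>(s, q\<^sup>2 s)\<close> extends by the factor \<open>q\<close>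
      to either side of \<open>q s\<close>. Missing \<open>E\<close>, it keeps \<open>q s\<close>
      out of the blow-up; missing the complement, it forces \<open>q s\<close> into it.\<close>
    moreover have "q\<^sup>2 > 1" using q by (simp add: one_less_power)
    ultimately obtain s where s: "0 < s" "{s<..<q\<^sup>2 * s} \<inter> (E \<union> ({0..} - blow_up q E)) = {}"
      unfolding SP_iff using zero_less_one by meson
    have "q * s \<in> {s<..<q\<^sup>2 * s}" using s q by (simp add: power2_eq_square)
    moreover have "q * s \<in> {0..}" using s q by simp
    ultimately have "q * s \<in> blow_up q E" using s(2) by blast
    moreover have "{q * s / q<..<q * (q * s)} \<inter> E = {}"
      using s q by (auto simp: power2_eq_square mult.assoc)
    ultimately show False using gap_iff_notin_blow_up[OF q] by blast
  qed
next
  assume free: "\<forall>q>1. long_free (blow_up q E)"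
  show "\<forall>A\<in>SP. E \<union> A \<in> SP"
  proof
    fix A assume A: "A \<in> SP"
    show "E \<union> A \<in> SP"
      unfolding SP_iff
    proof (intro conjI allI impI)
      show "E \<union> A \<subseteq> {0..}" using E A unfolding SP_def by blast
      fix q \<epsilon> :: real assume q: "q > 1" and e: "\<epsilon> > 0"
      obtain M \<delta> where M: "M > 1" "\<delta> > 0"
        and sh: "\<And>u. 0 < u \<Longrightarrow> u < \<delta> \<Longrightarrow> \<not> {u<..<M * u} \<subseteq> blow_up q E"
        using free q unfolding long_free_def by blast
      \<comment> \<open>A gap \<open>(u, L u)\<close> of \<open>A\<close> contains
        \<open>(q u, M q u)\<close> with a factor \<open>q\<close> to spare at both ends, so
        \<open>(x / q, q x)\<close> stays inside it for every \<open>x\<close> found there.\<close>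
      define L where "L = M * q\<^sup>2"
      have L: "L > 1" unfolding L_def using M q by (simp add: less_1_mult one_less_power)
      \<comment> \<open>The first bound gives \<open>q u < \<delta>\<close>, so that
        \<open>sh\<close> applies at \<open>q u\<close>; the second keeps the whole gap below
        \<open>\<epsilon>\<close>.\<close>
      define \<eta> where "\<eta> = min (\<delta> / q) (\<epsilon> / L)"
      have "\<eta> > 0" using M e q L by (simp add: \<eta>_def)
      then obtain u where u: "0 < u" "u < \<eta>" "{u<..<L * u} \<inter> A = {}"
        using A L unfolding SP_iff by meson
      have u': "q * u < \<delta>" "L * u < \<epsilon>" using u q L by (simp_all add: \<eta>_def field_simps)
      obtain x where x: "q * u < x" "x < M * (q * u)" "x \<notin> blow_up q E"
        using sh[of "q * u"] u' u q by (force simp: subset_iff)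
      have qx: "u < x / q" "q * x < L * u"
        using x q by (simp_all add: L_def field_simps power2_eq_square)
      have "0 < q * u" using u q by simp
      then have "x > 0" using x(1) by linarith
      then have "1 * x < q * x" using q by (intro mult_strict_right_mono)
      then have "x < q * x" by simp
      then have "x / q < x" using q by (simp add: pos_divide_less_eq mult.commute)
      have "q * (x / q) = x" using q by simp
      \<comment> \<open>The left half \<open>(x / q, x)\<close> already has ratio \<open>q\<close>,
        the ratio demanded of \<open>E \<union> A\<close> and also the blow-up factor.\<close>
      have "{x / q<..<x} \<subseteq> {u<..<L * u}" "{x / q<..<x} \<subseteq> {x / q<..<q * x}"
        using qx \<open>x < q * x\<close> by (simp_all add: subset_iff)
      then have "{x / q<..<x} \<inter> A = {}" "{x / q<..<x} \<inter> E = {}"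
        using u(3) x(3) gap_iff_notin_blow_up[OF q, of x E] by blast+
      then have "{x / q<..<q * (x / q)} \<inter> (E \<union> A) = {}"
        using \<open>q * (x / q) = x\<close> by auto
      moreover have "0 < x / q" "x / q < \<epsilon>"
        using qx u' \<open>u > 0\<close> \<open>x < q * x\<close> \<open>x / q < x\<close> by linarith+
      ultimately show "\<exists>u. 0 < u \<and> u < \<epsilon> \<and> {u<..<q * u} \<inter> (E \<union> A) = {}" by blast
    qed
  qed
qed

section \<open>Components of the blow-up near 0 and the ratios of their endpoints\<close>

lemma Cc1_below:
  assumes E: "E \<subseteq> {0..}" "0 islimpt E" and q: "q > 1" and free: "long_free (blow_up q E)"
    and e: "\<epsilon> > 0"
  obtains C where "C \<in> Cc1 q E" "C \<subseteq> {0<..<\<epsilon>}"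
proof -
  obtain M \<delta> where M: "M > 1" "\<delta> > 0"
    and sh: "\<And>u. 0 < u \<Longrightarrow> u < \<delta> \<Longrightarrow> \<not> {u<..<M * u} \<subseteq> blow_up q E"
    using free unfolding long_free_def by blast
  \<comment> \<open>Dividing by \<open>M\<close> puts all of \<open>(u, M u)\<close> below
    \<open>min 1 \<epsilon>\<close>. Its point \<open>x\<close> outside the blow-up is then a
    barrier below both 1 and \<open>\<epsilon>\<close>.\<close>
  define \<eta> where "\<eta> = min 1 \<epsilon> / M"
  define u where "u = min (\<delta> / 2) \<eta>"
  have "0 < u" "u < \<delta>" "u \<le> min 1 \<epsilon> / M" using M e by (auto simp: u_def \<eta>_def)
  then obtain x where x: "u < x" "x < M * u" "x \<notin> blow_up q E" using sh[of u] by (force simp: subset_iff)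
  have "M * u \<le> min 1 \<epsilon>" using \<open>u \<le> min 1 \<epsilon> / M\<close> M by (simp add: field_simps)
  then have x': "0 < x" "x < 1" "x < \<epsilon>" using x \<open>0 < u\<close> by linarith+
  obtain y where y: "y \<in> E" "y \<noteq> 0" "dist y 0 < x" using E(2) x'(1) unfolding islimpt_approachable by blast
  then have y': "0 < y" "y < x" using E(1) by auto
  define C where "C = connected_component_set (blow_up q E) y"
  have yU: "y \<in> blow_up q E" using mem_blow_up y(1) y'(1) q by blast
  then have yC: "y \<in> C" and C: "C \<in> components (blow_up q E)"
    unfolding C_def components_def by auto
  have CU: "C \<subseteq> blow_up q E" using C in_components_subset by blast
  \<comment> \<open>The component starts from \<open>y < x\<close>, is connected and omits
    \<open>x\<close>, so it cannot pass \<open>x\<close>.\<close>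
  have "z < x" if z: "z \<in> C" for z
  proof (rule ccontr)
    assume "\<not> z < x"
    moreover have "connected C" using C in_components_connected by blast
    ultimately have "x \<in> C" using yC z y' unfolding connected_iff_interval by fastforce
    then show False using CU x by blast
  qed
  then have "C \<subseteq> {0<..<x}" using CU blow_up_pos[OF E(1) q] by auto
  then have "C \<subseteq> {0<..1}" "C \<subseteq> {0<..<\<epsilon>}" using x' by force+
  then show thesis using that C unfolding Cc1_def by blast
qed

text \<open>Positive points chosen from finitely many components would have a positive minimum, yet
  some component lies entirely below it.\<close>

lemma long_free_imp_infinite_Cc1:
  assumes E: "E \<subseteq> {0..}" "0 islimpt E" and q: "q > 1" and free: "long_free (blow_up q E)"
  shows "infinite (Cc1 q E)"
proof
  assume fin: "finite (Cc1 q E)"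
  have "\<exists>z. z \<in> C \<and> 0 < z" if "C \<in> Cc1 q E" for C
    using that in_components_nonempty unfolding Cc1_def by fastforce
  then obtain p where p: "\<And>C. C \<in> Cc1 q E \<Longrightarrow> p C \<in> C \<and> 0 < p C" by metis
  \<comment> \<open>The 1 makes the minimum meaningful even if \<open>Cc1 q E\<close> is
    empty.\<close>
  define m where "m = Min (insert 1 (p ` Cc1 q E))"
  have "m > 0" unfolding m_def using fin p by (subst Min_gr_iff) auto
  then obtain C where C: "C \<in> Cc1 q E" "C \<subseteq> {0<..<m}" using Cc1_below[OF E q free] by blast
  then have "p C < m" using p by fastforce
  moreover have "m \<le> p C" unfolding m_def using fin C by (intro Min_le) auto
  ultimately show False by simp
qed

lemma right_of_open_intervals:
  fixes a b c d :: real
  assumes "right_of {a<..<b} {c<..<d}" "a < b" "c < d"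
  shows "d \<le> a"
proof (rule ccontr)
  assume "\<not> d \<le> a"
  then have "max a c < d" using assms(3) by simp
  then obtain y where y: "max a c < y" "y < d" using dense by blast
  then have "a < min b y" using assms(2) by simp
  then obtain x where "a < x" "x < min b y" using dense by blast
  then have "x \<in> {a<..<b}" "y \<in> {c<..<d}" "x < y" using y by auto
  then show False using assms(1) unfolding right_of_def by (meson less_asym)
qed

text \<open>Late components are themselves intervals of the blow-up near 0, and conversely an
  interval of the blow-up that starts below \<open>a N\<close> lies in a component listed after the
  \<open>N\<close>-th.\<close>

lemma long_free_iff_limsup:
  assumes E: "E \<subseteq> {0..}" "0 islimpt E" and q: "q > 1"
    and ab: "lists_right_to_left a b (Cc1 q E)"
  shows "long_free (blow_up q E) \<longleftrightarrow> limsup (\<lambda>i. ereal (b i / a i)) < \<infinity>"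
proof
  have lt: "\<And>i. a i < b i" and rng: "range (\<lambda>i. {a i<..<b i}) = Cc1 q E"
    and ord: "\<And>i j. right_of {a i<..<b i} {a j<..<b j} \<longleftrightarrow> i < j"
    using ab unfolding lists_right_to_left_def by blast+
  have pos: "a i > 0" for i using lists_right_to_left_Cc1_pos[OF ab] .
  have comp: "{a i<..<b i} \<in> components (blow_up q E)" "{a i<..<b i} \<subseteq> {0<..1}" for i
    using rng unfolding Cc1_def by blast+
  {
    assume free: "long_free (blow_up q E)"
    then obtain M \<delta> where M: "M > 1" "\<delta> > 0"
      and sh: "\<And>u. 0 < u \<Longrightarrow> u < \<delta> \<Longrightarrow> \<not> {u<..<M * u} \<subseteq> blow_up q E"
      unfolding long_free_def by blast
    \<comment> \<open>Every component listed after one inside \<open>(0, \<delta>)\<close> starts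
      below \<open>\<delta>\<close>, so \<open>sh\<close> bounds its ratio by
      \<open>M\<close>.\<close>
    obtain C where C: "C \<in> range (\<lambda>i. {a i<..<b i})" "C \<subseteq> {0<..<\<delta>}"
      using Cc1_below[OF E q free M(2)] unfolding rng by blast
    then obtain n where "{a n<..<b n} \<subseteq> {0<..<\<delta>}" by blast
    then have "b n \<le> \<delta>"
      using lt[of n] unfolding greaterThanLessThan_subseteq_greaterThanLessThan by auto
    have "b i / a i \<le> M" if "i > n" for i
    proof (rule ccontr)
      assume "\<not> b i / a i \<le> M"
      then have "M * a i < b i" using pos[of i] by (simp add: field_simps)
      moreover have "b i \<le> a n" by (rule right_of_open_intervals) (use ord that lt in auto)
      then have "a i < \<delta>" using lt[of i] lt[of n] \<open>b n \<le> \<delta>\<close> by linarith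
      ultimately have "{a i<..<M * a i} \<subseteq> {a i<..<b i}" "\<not> {a i<..<M * a i} \<subseteq> blow_up q E"
        using sh[OF pos] by (simp_all add: subset_iff)
      then show False using comp(1)[of i] in_components_subset by blast
    qed
    then have "\<forall>\<^sub>F i in sequentially. ereal (b i / a i) \<le> ereal M"
      unfolding eventually_sequentially by (intro exI[of _ "Suc n"]) auto
    then have "limsup (\<lambda>i. ereal (b i / a i)) \<le> ereal M" by (rule Limsup_bounded)
    then show "limsup (\<lambda>i. ereal (b i / a i)) < \<infinity>" by (rule le_less_trans) simp
  }
  {
    assume "limsup (\<lambda>i. ereal (b i / a i)) < \<infinity>"
    then obtain c where c: "limsup (\<lambda>i. ereal (b i / a i)) < c" "c < \<infinity>" using dense by blast
    then obtain M0 where M0: "c \<le> ereal M0" by (cases c) auto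
    have "\<forall>\<^sub>F i in sequentially. b i / a i < M0"
      using Limsup_lessD[OF c(1)] by eventually_elim (use M0 less_le_trans in fastforce)
    then obtain N where N: "\<And>i. i \<ge> N \<Longrightarrow> b i / a i < M0"
      unfolding eventually_sequentially by blast
    define M where "M = max 2 M0"
    have "\<not> {u<..<M * u} \<subseteq> blow_up q E" if u: "0 < u" "u < a N" for u
    proof
      assume sub: "{u<..<M * u} \<subseteq> blow_up q E"
      have uM: "u < M * u" using u by (simp add: M_def)
      \<comment> \<open>Taking \<open>x\<close> below \<open>a N\<close> makes its component differ
        from the \<open>N\<close>-th, although \<open>(u, M u)\<close> might a priori reach beyond
        \<open>a N\<close>.\<close>
      then obtain x where x: "u < x" "x < min (a N) (M * u)" using dense[of u "min (a N) (M * u)"] u by auto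
      define D where "D = connected_component_set (blow_up q E) x"
      have xU: "x \<in> blow_up q E" using sub x by auto
      then have D: "D \<in> components (blow_up q E)" and xD: "x \<in> D" unfolding D_def components_def by auto
      have subD: "{u<..<M * u} \<subseteq> D"
        by (rule components_maximal[OF D _ sub]) (use x xD in auto)
      have "{a N<..<b N} \<inter> D = {}"
      proof -
        have "x \<notin> {a N<..<b N}" using x by simp
        then have "{a N<..<b N} \<noteq> D" using xD by blast
        then show ?thesis using components_nonoverlap[OF comp(1) D] by blast
      qed
      \<comment> \<open>If \<open>D\<close> reached from \<open>x < a N\<close> beyond
        \<open>a N\<close>, connectedness would make it meet \<open>(a N, b N)\<close>.\<close>
      then have Dle: "z \<le> a N" if "z \<in> D" for z
      proof -
        have "False" if "z > a N"
        proof -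
          have "a N < min z (b N)" using that lt by simp
          then obtain w where w: "a N < w" "w < min z (b N)" using dense by blast
          then have "x \<le> w" "w \<le> z" using x by linarith+
          then have "w \<in> D" using \<open>z \<in> D\<close> xD in_components_connected[OF D]
            unfolding connected_iff_interval by blast
          then show False using w \<open>{a N<..<b N} \<inter> D = {}\<close> by auto
        qed
        then show ?thesis by force
      qed
      \<comment> \<open>This places \<open>D\<close> inside \<open>(0, 1]\<close>, so it occurs in
        the list; lying to the left of the \<open>N\<close>-th component, it has an index
        \<open>j > N\<close>.\<close>
      moreover have "a N \<le> 1"
      proof -
        obtain z where "a N < z" "z < b N" using dense[OF lt] by blast
        then have "z \<in> {0<..1}" using comp(2)[of N] by (meson greaterThanLessThan_iff subsetD)
        then show ?thesis using \<open>a N < z\<close> by simp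
      qed
      moreover have "D \<subseteq> {0<..}" using in_components_subset[OF D] blow_up_pos[OF E(1) q] by auto
      ultimately have "D \<in> Cc1 q E" using D unfolding Cc1_def by force
      then obtain j where j: "D = {a j<..<b j}" using rng by blast
      have "right_of {a N<..<b N} D" using Dle unfolding right_of_def by fastforce
      then have "N < j" using j ord by simp
      then have "b j / a j < M0" using N by simp
      then have "b j / a j < M" by (simp add: M_def)
      then have "b j < M * a j" using pos[of j] by (simp add: pos_divide_less_eq)
      \<comment> \<open>Containing \<open>(u, M u)\<close> forces \<open>b j / a j\<close> to be at
        least \<open>M\<close>, against the bound for late indices.\<close>
      moreover have "a j \<le> u" "M * u \<le> b j"
        using subD uM unfolding j greaterThanLessThan_subseteq_greaterThanLessThan by auto
      moreover have "M * a j \<le> M * u" using \<open>a j \<le> u\<close> by (intro mult_left_mono) (simp_all add: M_def)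
      ultimately show False by linarith
    qed
    moreover have "M > 1" by (simp add: M_def)
    ultimately show "long_free (blow_up q E)" unfolding long_free_def using pos by blast
  }
qed

theorem theorem6p6:
  fixes E :: "real set"
  assumes "E \<subseteq> {0..}"
    and "0 islimpt E"
  shows "E \<in> hat_I_SP \<longleftrightarrow>
    (\<forall>q>1. infinite (Cc1 q E) \<and>
       (\<exists>a b. lists_right_to_left a b (Cc1 q E) \<and>
              limsup (\<lambda>i. ereal (b i / a i)) < \<infinity>))"
proof -
  \<comment> \<open>The equivalence holds for each \<open>q\<close> separately: freeness gives
    infinitely many components, hence an enumeration, and the criterion with the upper limit is
    valid for any enumeration.\<close>
  have "long_free (blow_up q E) \<longleftrightarrow>
      infinite (Cc1 q E) \<and>
      (\<exists>a b. lists_right_to_left a b (Cc1 q E) \<and> limsup (\<lambda>i. ereal (b i / a i)) < \<infinity>)"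
    if q: "q > 1" for q
    using long_free_iff_limsup[OF assms q] long_free_imp_infinite_Cc1[OF assms q]
      lists_right_to_left_Cc1_exists[OF q assms(1)] by blast
  then show ?thesis
    using hat_I_SP_iff union_in_SP_iff_long_free[OF assms(1)] by simp
qed

end
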